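(* Let $p,q\in(0,1)$ and let $(X_n,\ n\geq 0)$ be the discrete-time (time-homogeneous) Markov chain on $S=\{0,1\}$ with 1-step transition matrix (rows and columns indexed by $0,1$ in this order) $$P=\begin{pmatrix}1-p & p\\ q & 1-q\end{pmatrix}.$$ For $n\geq 1$ let $N_n=\sum_{m=1}^n 1_{\{X_m=0\}}$ be the number of visits to state $0$ during times $1,\dots,n$, and for $i\in\{0,1\}$ and $0\leq k\leq n$ let $g_i(n,k)=\Pr(N_n=k\mid X_0=i)$. If $p+q=1$, then, for both $i\in\{0,1\}$ and all $n\ge 1$, $$g_i(n,k)=\binom{n}{k}q^k p^{n-k},\qquad 0\leq k\leq n.$$ Otherwise (that is, if $p+q\neq 1$), set $r=1-p-q$. Then: (a) $g_0(n,n)=(1-p)^n$ for $n\ge 1$, and, for $n\geq 1$ and $0\leq k\leq n-1$, $$g_0(n,k)=p(1-q)^{n-(2k+1)}\sum_{j=0}^{\min\{k,\,n-k\}}\binom{n-k}{j}\binom{n-j}{k-j}\left(1-\frac{j}{n-k}\,q\right)(1-q)^{k-j}(1-p)^{k-j}(-r)^j.$$ (b) $g_1(n,0)=(1-q)^n$ for $n\ge 1$, and, for $n\geq 1$ and $1\leq k\leq n$, $$g_1(n,k)=q(1-p)^{2k-1-n}\sum_{j=0}^{\min\{k,\,n-k\}}\binom{k}{j}\binom{n-j}{n-k-j}\left(1-\frac{j}{k}\,p\right)(1-p)^{n-k-j}(1-q)^{n-k-j}(-r)^j.$$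
   Context: The initial state $X_0$ does not contribute to $N_n$. The exponents $n-(2k+1)$ and $2k-1-n$ are integers that may be negative. *)

theory Defs
  imports "HOL-Probability.Probability"
begin

text \<open>The Markov property is stated for every finite history of positive probability, since
  conditional probabilities given null events are meaningless (\<^const>\<open>cond_prob\<close> returns 0).
  The initial distribution is arbitrary.\<close>

definition markov_chain ::
    "'a measure \<Rightarrow> 's set \<Rightarrow> ('s \<Rightarrow> 's \<Rightarrow> real) \<Rightarrow> (nat \<Rightarrow> 'a \<Rightarrow> 's) \<Rightarrow> bool" where
  "markov_chain M S P X \<longleftrightarrow>
     prob_space M \<and> countable S \<and>
     (\<forall>n. X n \<in> measurable M (count_space S)) \<and>
     (\<forall>n x. (\<forall>m\<le>Suc n. x m \<in> S) \<longrightarrow>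
        \<P>(\<omega> in M. \<forall>m\<le>n. X m \<omega> = x m) > 0 \<longrightarrow>
        \<P>(\<omega> in M. X (Suc n) \<omega> = x (Suc n) \<bar> \<forall>m\<le>n. X m \<omega> = x m) = P (x n) (x (Suc n)))"

definition two_state_matrix :: "real \<Rightarrow> real \<Rightarrow> nat \<Rightarrow> nat \<Rightarrow> real" where
  "two_state_matrix p q i j =
     (if i = 0 then (if j = 0 then 1 - p else p)
      else (if j = 0 then q else 1 - q))"

definition visits :: "(nat \<Rightarrow> 'a \<Rightarrow> nat) \<Rightarrow> nat \<Rightarrow> 'a \<Rightarrow> nat" where
  "visits X n \<omega> = (\<Sum>m=1..n. of_bool (X m \<omega> = 0))"

text \<open>Meaningful only if \<open>X 0 = i\<close> has positive probability.\<close>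

definition visit_prob :: "'a measure \<Rightarrow> (nat \<Rightarrow> 'a \<Rightarrow> nat) \<Rightarrow> nat \<Rightarrow> nat \<Rightarrow> nat \<Rightarrow> real" where
  "visit_prob M X i n k = \<P>(\<omega> in M. visits X n \<omega> = k \<bar> X 0 \<omega> = i)"

end

(* Let a(k,m) and b(k,m) be the probabilities of k visits to 0 and m visits to 1 during times
   1, ..., k+m, starting from 0 and from 1 respectively. Conditioning on the first step gives linear
   recurrences for them; for fixed m the generating functions A_m(x), B_m(x) in k then satisfy
     B_m = (1 - r x) (1-q - r x)^m / (1 - (1-p) x)^(m+1),
     A_(m+1) = p B_m / (1 - (1-p) x).
   Extracting the coefficient of x^k from A_(m+1) yields (a): the factor 1/(1 - (1-p) x)^(m+2)
   contributes binom(n-j, k-j) (1-p)^(k-j), and (1 - r x) (1-q - r x)^m contributes the rest.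
   Swapping the roles of the two states exchanges p with q and k with n-k, which gives (b). *)
theory Submission
  imports Defs
begin

unbundle no vec_syntax and fps_syntax

section \<open>First-step recursion for the law of the number of visits\<close>

text \<open>First-step analysis as a purely numerical recursion: a step to 1 leaves all
  \<open>k\<close> visits to come, a step to 0 uses up one, which is impossible for
  \<open>k = 0\<close>.\<close>

primrec visit_law :: "(nat \<Rightarrow> nat \<Rightarrow> real) \<Rightarrow> nat \<Rightarrow> nat \<Rightarrow> nat \<Rightarrow> real" where
  "visit_law P i 0 k = of_bool (k = 0)"
| "visit_law P i (Suc n) k =
     P i 1 * visit_law P 1 n k + (case k of 0 \<Rightarrow> 0 | Suc k' \<Rightarrow> P i 0 * visit_law P 0 n k')"

lemma visit_law_eq_0: "n < k \<Longrightarrow> visit_law P i n k = 0"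
  by (induction n arbitrary: i k) (auto split: nat.splits)

lemma visit_law_0_right: "visit_law P 1 n 0 = P 1 1 ^ n"
  by (induction n) auto

lemma visit_law_diagonal: "visit_law P 0 n n = P 0 0 ^ n"
  by (induction n) (auto simp: visit_law_eq_0)

text \<open>Relabelling the states exchanges \<open>p\<close> with \<open>q\<close> and turns visits
  to 0 into visits to 1. The extreme values of \<open>k\<close> are separate cases because one of
  the two first steps then contributes nothing.\<close>

lemma visit_law_swap_states:
  assumes "i \<in> {0, 1}" "k \<le> n"
  shows "visit_law (two_state_matrix p q) i n k =
         visit_law (two_state_matrix q p) (1 - i) n (n - k)"
  using assms
proof (induction n arbitrary: i k)
  case 0
  then show ?case by simp
next
  case (Suc n)
  consider "k = 0" | k' where "k = Suc k'" "k' = n" | k' where "k = Suc k'" "k' < n"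
    using Suc.prems by (cases k) force+
  then show ?case
  proof cases
    case 1
    then show ?thesis
      using Suc.prems Suc.IH[of 1 0] by (auto simp: two_state_matrix_def visit_law_eq_0)
  next
    case (2 k')
    then show ?thesis
      using Suc.prems Suc.IH[of 0 n] by (auto simp: two_state_matrix_def visit_law_eq_0)
  next
    case (3 k')
    then obtain l where l: "n - k' = Suc l" "n - Suc k' = l"
      by (metis Suc_diff_Suc)
    show ?thesis
      using Suc.prems Suc.IH[of 1 "Suc k'"] Suc.IH[of 0 k'] 3 l
      by (auto simp: two_state_matrix_def)
  qed
qed

text \<open>Both rows of the matrix are \<open>(q, p)\<close>, so the starting state is irrelevant
  and the recursion becomes Pascal's rule for the binomial law.\<close>

lemma visit_law_iid:
  assumes "p + q = 1" "k \<le> n"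
  shows "visit_law (two_state_matrix p q) i n k = real (n choose k) * q ^ k * p ^ (n - k)"
  using assms(2)
proof (induction n arbitrary: i k)
  case 0
  then show ?case by simp
next
  case (Suc n)
  have row: "two_state_matrix p q i 1 = p" "two_state_matrix p q i 0 = q"
    using assms(1) by (auto simp: two_state_matrix_def)
  consider "k = 0" | k' where "k = Suc k'" "k' = n" | k' where "k = Suc k'" "k' < n"
    using Suc.prems by (cases k) force+
  then show ?case
  proof cases
    case 1
    then show ?thesis using Suc.IH[of 0] row by simp
  next
    case (2 k')
    then show ?thesis using Suc.IH[of n] row by (simp add: visit_law_eq_0)
  next
    case (3 k')
    then obtain l where l: "n = k' + Suc l"
      by (metis less_natE add_Suc_right)
    show ?thesis
      using Suc.IH[of "Suc k'"] Suc.IH[of k'] 3 row by (simp add: l algebra_simps)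
  qed
qed

section \<open>Generating functions for a fixed number of visits to 1\<close>

text \<open>Fixing the number \<open>m\<close> of visits to 1, rather than the time
  \<open>k + m\<close>, makes a step to 0 a multiplication by \<open>fps_X\<close>.\<close>

definition visit_fps :: "(nat \<Rightarrow> nat \<Rightarrow> real) \<Rightarrow> nat \<Rightarrow> nat \<Rightarrow> real fps" where
  "visit_fps P i m = Abs_fps (\<lambda>k. visit_law P i (k + m) k)"

text \<open>The summand 1 is the empty path; with no visit to 1 allowed, only a first step to 0
  remains.\<close>

lemma visit_fps_0:
  "visit_fps P i 0 = 1 + fps_const (P i 0) * fps_X * visit_fps P 0 0"
proof (rule fps_ext)
  fix k show "visit_fps P i 0 $ k = (1 + fps_const (P i 0) * fps_X * visit_fps P 0 0) $ k"
    by (cases k) (auto simp: visit_fps_def visit_law_eq_0 mult.assoc)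
qed

lemma visit_fps_Suc:
  "visit_fps P i (Suc m) =
     fps_const (P i 1) * visit_fps P 1 m + fps_const (P i 0) * fps_X * visit_fps P 0 (Suc m)"
proof (rule fps_ext)
  fix k
  show "visit_fps P i (Suc m) $ k = (fps_const (P i 1) * visit_fps P 1 m +
          fps_const (P i 0) * fps_X * visit_fps P 0 (Suc m)) $ k"
    by (cases k) (auto simp: visit_fps_def mult.assoc)
qed

context
  fixes p q r :: real
  assumes r: "r = 1 - p - q"
begin

private abbreviation (input) "P \<equiv> two_state_matrix p q"
private abbreviation (input) "D \<equiv> 1 - fps_const (1 - p) * fps_X"

lemma D_mult_visit_fps_0: "D * visit_fps P 0 0 = 1"
  using visit_fps_0[of P 0] by (simp add: two_state_matrix_def algebra_simps)

lemma D_mult_visit_fps_Suc: "D * visit_fps P 0 (Suc m) = fps_const p * visit_fps P 1 m"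
  using visit_fps_Suc[of P 0 m] by (simp add: two_state_matrix_def algebra_simps)

text \<open>Multiplying the recurrence for start 1 by \<open>D\<close> eliminates start 0, so each
  further visit to 1 contributes one linear factor over \<open>D\<close>.\<close>

lemma D_power_mult_visit_fps_1:
  "D ^ Suc m * visit_fps P 1 m =
     (1 - fps_const r * fps_X) * (fps_const (1 - q) - fps_const r * fps_X) ^ m"
proof (induction m)
  case 0
  have "D * visit_fps P 1 0 = D + fps_const q * fps_X * (D * visit_fps P 0 0)"
    using visit_fps_0[of P 1] by (simp add: two_state_matrix_def algebra_simps)
  also have "\<dots> = 1 - fps_const r * fps_X"
    unfolding D_mult_visit_fps_0 r
    by (simp add: algebra_simps flip: fps_const_sub fps_const_add fps_const_mult)
  finally show ?case by simp
next
  case (Suc m)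
  have "D * visit_fps P 1 (Suc m) =
      fps_const (1 - q) * D * visit_fps P 1 m + fps_const q * fps_X * (D * visit_fps P 0 (Suc m))"
    using visit_fps_Suc[of P 1 m] by (simp add: two_state_matrix_def algebra_simps)
  \<comment> \<open>The coefficient of \<open>fps_X\<close> comes from
    \<open>(1 - q) * (1 - p) - p * q = r\<close>, the determinant of the matrix.\<close>
  also have "\<dots> = (fps_const (1 - q) - fps_const r * fps_X) * visit_fps P 1 m"
    unfolding D_mult_visit_fps_Suc r
    by (simp add: algebra_simps flip: fps_const_sub fps_const_add fps_const_mult)
  finally have "D ^ Suc (Suc m) * visit_fps P 1 (Suc m) =
      (fps_const (1 - q) - fps_const r * fps_X) * (D ^ Suc m * visit_fps P 1 m)"
    by (simp add: mult.left_commute mult.commute)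
  then show ?case unfolding Suc.IH by (simp only: power_Suc mult_ac)
qed

lemma visit_fps_0_Suc:
  "visit_fps P 0 (Suc m) =
     fps_const p * (1 - fps_const r * fps_X) * (fps_const (1 - q) - fps_const r * fps_X) ^ m *
     inverse (D ^ Suc (Suc m))"
proof -
  have "D ^ Suc (Suc m) * visit_fps P 0 (Suc m) = D ^ Suc m * (D * visit_fps P 0 (Suc m))"
    by (simp add: mult_ac)
  also have "\<dots> = fps_const p * (D ^ Suc m * visit_fps P 1 m)"
    unfolding D_mult_visit_fps_Suc by (simp add: mult_ac)
  finally have eq: "D ^ Suc (Suc m) * visit_fps P 0 (Suc m) = fps_const p *
      ((1 - fps_const r * fps_X) * (fps_const (1 - q) - fps_const r * fps_X) ^ m)"
    unfolding D_power_mult_visit_fps_1 .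
  have "(D ^ Suc (Suc m)) $ 0 \<noteq> 0"
    by (simp add: fps_nth_power_0)
  then have inv: "inverse (D ^ Suc (Suc m)) * D ^ Suc (Suc m) = 1"
    by (rule inverse_mult_eq_1)
  have "visit_fps P 0 (Suc m) =
      inverse (D ^ Suc (Suc m)) * (D ^ Suc (Suc m) * visit_fps P 0 (Suc m))"
    using inv by (simp only: mult.assoc[symmetric]) simp
  then show ?thesis unfolding eq by (simp add: mult_ac)
qed

end

section \<open>Extraction of the coefficients\<close>

lemma fps_nth_linear_power:
  fixes b c :: "'a::comm_ring_1"
  shows "((fps_const b + fps_const c * fps_X) ^ m) $ j = of_nat (m choose j) * c ^ j * b ^ (m - j)"
proof -
  have "(fps_const b + fps_const c * fps_X) ^ m = (fps_const c * fps_X + fps_const b) ^ m"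
    by (simp add: add.commute)
  also have "\<dots> = (\<Sum>i\<le>m. fps_const (of_nat (m choose i) * c ^ i * b ^ (m - i)) * fps_X ^ i)"
    unfolding binomial_ring
    by (intro sum.cong)
      (simp_all add: power_mult_distrib fps_of_nat mult_ac flip: fps_const_mult fps_const_power)
  also have "\<dots> $ j = (\<Sum>i\<le>m. if i = j then of_nat (m choose i) * c ^ i * b ^ (m - i) else 0)"
    unfolding fps_sum_nth by (intro sum.cong) auto
  also have "\<dots> = of_nat (m choose j) * c ^ j * b ^ (m - j)"
    by (simp add: binomial_eq_0)
  finally show ?thesis .
qed


text \<open>Cauchy product, in degree \<open>k\<close>, of the numerator polynomial and a negative
  binomial series. The bound \<open>q < 1\<close> makes \<open>1 - q\<close> nonzero, so that its
  possibly negative power is a genuine one.\<close>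

lemma visit_law_formula:
  assumes "k < n" "q < 1"
  shows "visit_law (two_state_matrix p q) 0 n k =
    p * (1 - q) powi (int n - (2 * int k + 1)) *
    (\<Sum>j=0..min k (n - k).
       real ((n - k) choose j) * real ((n - j) choose (k - j)) *
       (1 - real j / real (n - k) * q) *
       (1 - q) ^ (k - j) * (1 - p) ^ (k - j) * (- (1 - p - q)) ^ j)"
proof -
  define r b where "r = 1 - p - q" and "b = 1 - q"
  obtain m where m: "n = k + Suc m"
    using assms(1) by (metis less_natE add_Suc_right)
  \<comment> \<open>\<open>c j\<close> is the coefficient of degree \<open>j\<close> in
    \<open>(1 - r x) (b - r x)^m\<close> with \<open>(- r) ^ j\<close> factored out; the second term
    comes from \<open>- r x\<close> in the first factor.\<close>
  define c where "c j = real (m choose j) * b ^ (m - j) +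
    (if j = 0 then 0 else real (m choose (j - 1)) * b ^ (Suc m - j))" for j
  have b: "b > 0" using assms(2) by (simp add: b_def)
  have "(fps_const b - fps_const r * fps_X) ^ m $ j =
      real (m choose j) * (- r) ^ j * b ^ (m - j)" for j
    using fps_nth_linear_power[of b "- r" m j] by (simp flip: fps_const_neg)
  then have num: "((1 - fps_const r * fps_X) * (fps_const b - fps_const r * fps_X) ^ m) $ j =
      (- r) ^ j * c j" for j
    by (cases j) (simp_all add: c_def left_diff_distrib mult.assoc algebra_simps)
  have den: "inverse ((1 - fps_const (1 - p) * fps_X) ^ Suc (Suc m)) $ i =
      real ((Suc m + i) choose i) * (1 - p) ^ i" for i
    by (subst one_minus_const_fps_X_neg_power') simp_all
  \<comment> \<open>The factor \<open>b\<close> on both sides avoids the exponent \<open>m - j\<close>, which truncates at \<open>j = Suc m\<close>.\<close>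
  have c_Suc: "real (Suc m) * c j * b =
      real (Suc m choose j) * (real (Suc m) - real j * q) * b ^ (Suc m - j)"
    if "j \<le> Suc m" for j
  proof (cases j)
    case 0
    then show ?thesis by (simp add: c_def)
  next
    case (Suc i)
    have i: "i \<le> m" using that Suc by simp
    \<comment> \<open>Absorption here, and Pascal's rule below, rewrite both binomial coefficients
      in terms of \<open>Suc m choose Suc i\<close>.\<close>
    have 1: "real (Suc m) * real (m choose i) = real (Suc i) * real (Suc m choose Suc i)"
      by (metis Suc_times_binomial of_nat_mult)
    have "real (Suc m) * real (m choose Suc i) =
        real (Suc m) * real (Suc m choose Suc i) - real (Suc m) * real (m choose i)"
      by (simp add: algebra_simps)
    then have 2: "real (Suc m) * real (m choose Suc i) =
        (real (Suc m) - real (Suc i)) * real (Suc m choose Suc i)"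
      unfolding 1 by (simp add: algebra_simps)
    \<comment> \<open>For \<open>i = m\<close> the exponent \<open>m - Suc i\<close> truncates, but
      the binomial coefficient is then 0.\<close>
    have 3: "real (m choose Suc i) * b ^ (m - Suc i) * b = real (m choose Suc i) * b ^ (m - i)"
    proof (cases "i = m")
      case False
      then have "m - i = Suc (m - Suc i)" using i by simp
      then show ?thesis by simp
    qed simp
    have "real (Suc m) * c j * b = (real (Suc m) * real (m choose Suc i)) * b ^ (m - i)
        + (real (Suc m) * real (m choose i)) * b * b ^ (m - i)"
      using 3 by (simp add: c_def Suc algebra_simps del: of_nat_Suc)
    also have "\<dots> = real (Suc m choose Suc i) *
        ((real (Suc m) - real (Suc i)) + real (Suc i) * b) * b ^ (m - i)"
      unfolding 1 2 by (simp add: algebra_simps del: of_nat_Suc binomial_Suc_Suc)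
    \<comment> \<open>Since \<open>b = 1 - q\<close>,
      \<open>(m + 1 - j) + j * b = m + 1 - j * q\<close>; this is the origin of the factor
      \<open>1 - j / (n - k) * q\<close>.\<close>
    also have "\<dots> = real (Suc m choose Suc i) * (real (Suc m) - real (Suc i) * q) * b ^ (m - i)"
      by (simp add: b_def algebra_simps del: of_nat_Suc binomial_Suc_Suc)
    finally show ?thesis by (simp add: Suc)
  qed
  have c_0: "c j = 0" if "j > Suc m" for j
    using that by (simp add: c_def binomial_eq_0)
  have summand: "(- r) ^ j * c j * (real ((Suc m + (k - j)) choose (k - j)) * (1 - p) ^ (k - j)) =
      b powi (int n - (2 * int k + 1)) *
      (real ((n - k) choose j) * real ((n - j) choose (k - j)) *
       (1 - real j / real (n - k) * q) * b ^ (k - j) * (1 - p) ^ (k - j) * (- r) ^ j)"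
    if "j \<le> k" "j \<le> Suc m" for j
  proof -
    \<comment> \<open>The exponents add up to \<open>m - j\<close>, which is -1 for
      \<open>j = Suc m\<close>; hence the form \<open>b ^ (Suc m - j) / b\<close>.\<close>
    have "b powi (int n - (2 * int k + 1)) * b ^ (k - j) =
        b powi (int n - (2 * int k + 1)) * b powi int (k - j)"
      by simp
    also have "\<dots> = b powi (int (Suc m - j) - 1)"
      using that b by (subst power_int_add[symmetric]) (simp_all add: m of_nat_diff algebra_simps)
    also have "\<dots> = b ^ (Suc m - j) / b"
      using b by (simp add: power_int_diff del: power_Suc)
    finally have pow: "b powi (int n - (2 * int k + 1)) * b ^ (k - j) = b ^ (Suc m - j) / b" .
    have "c j = real (Suc m choose j) * (1 - real j / real (Suc m) * q) * (b ^ (Suc m - j) / b)"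
      using c_Suc[OF that(2)] b by (simp add: field_simps del: of_nat_Suc binomial_Suc_Suc)
    also have "\<dots> = real (Suc m choose j) * (1 - real j / real (Suc m) * q) *
        (b powi (int n - (2 * int k + 1)) * b ^ (k - j))"
      unfolding pow ..
    finally have cj: "c j = \<dots>" .
    have n: "n - k = Suc m" "Suc m + (k - j) = n - j"
      using that by (simp_all add: m)
    show ?thesis unfolding cj n by (simp only: mult_ac)
  qed
  have "visit_law (two_state_matrix p q) 0 n k = visit_fps (two_state_matrix p q) 0 (Suc m) $ k"
    by (simp add: visit_fps_def m)
  also have "\<dots> = (fps_const p *
     (((1 - fps_const r * fps_X) * (fps_const b - fps_const r * fps_X) ^ m) *
      inverse ((1 - fps_const (1 - p) * fps_X) ^ Suc (Suc m)))) $ k"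
    unfolding visit_fps_0_Suc[OF r_def] b_def by (simp only: mult.assoc)
  also have "\<dots> = p * (\<Sum>j=0..k. (- r) ^ j * c j *
      (real ((Suc m + (k - j)) choose (k - j)) * (1 - p) ^ (k - j)))"
    unfolding fps_mult_left_const_nth unfolding fps_mult_nth[where n = k] num den ..
  \<comment> \<open>The numerator has degree at most \<open>Suc m = n - k\<close>, which yields the
    upper limit \<open>min k (n - k)\<close>.\<close>
  also have "(\<Sum>j=0..k. (- r) ^ j * c j *
      (real ((Suc m + (k - j)) choose (k - j)) * (1 - p) ^ (k - j))) =
    (\<Sum>j=0..min k (n - k). (- r) ^ j * c j *
      (real ((Suc m + (k - j)) choose (k - j)) * (1 - p) ^ (k - j)))"
    by (rule sum.mono_neutral_right) (auto simp: m c_0)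
  also have "\<dots> = b powi (int n - (2 * int k + 1)) * (\<Sum>j=0..min k (n - k).
      real ((n - k) choose j) * real ((n - j) choose (k - j)) *
      (1 - real j / real (n - k) * q) * b ^ (k - j) * (1 - p) ^ (k - j) * (- r) ^ j)"
    unfolding sum_distrib_left by (intro sum.cong refl summand) (auto simp: m)
  finally show ?thesis by (simp add: b_def r_def mult.assoc)
qed

section \<open>Passage from the Markov chain to the recursion\<close>

text \<open>The Markov property conditions on full histories, so the induction generalises over the
  time \<open>t\<close> and the history \<open>x\<close>. The product form, unlike a conditional
  probability, stays meaningful for null histories.\<close>

lemma prob_history_visits:
  fixes X :: "nat \<Rightarrow> 'a \<Rightarrow> nat"
  assumes X: "markov_chain M {0, 1} P X" and x: "\<forall>m\<le>t. x m \<in> {0, 1}"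
  shows "\<P>(\<omega> in M. (\<forall>m\<le>t. X m \<omega> = x m) \<and> (\<Sum>m=Suc t..t + n. of_bool (X m \<omega> = 0)) = k) =
         \<P>(\<omega> in M. \<forall>m\<le>t. X m \<omega> = x m) * visit_law P (x t) n k"
  using x
proof (induction n arbitrary: t x k)
  case 0
  then show ?case by simp
next
  case (Suc n)
  interpret prob_space M using X by (simp add: markov_chain_def)
  have meas[measurable]: "X m \<in> measurable M (count_space {0, 1})" for m
    using X by (simp add: markov_chain_def)
  have X01: "X m \<omega> \<in> {0, 1}" if "\<omega> \<in> space M" for m \<omega>
    using measurable_space[OF meas that] by simp
  have [measurable]: "Measurable.pred M (\<lambda>\<omega>. X m \<omega> = c)" for m c
    by (rule measurable_compose[OF meas]) simp
  define S where "S t n \<omega> = (\<Sum>m=Suc t..t + n. of_bool (X m \<omega> = 0) :: nat)" for t n \<omega>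
  define H where "H t x \<omega> \<longleftrightarrow> (\<forall>m\<le>t. X m \<omega> = x m)" for t \<omega> and x :: "nat \<Rightarrow> nat"
  define step where "step s = x(Suc t := s)" for s
  have S_meas[measurable]: "S t n \<in> measurable M (count_space UNIV)" for t n
    unfolding S_def of_bool_def by measurable
  have H_meas[measurable]: "Measurable.pred M (H t x)" for t x
    unfolding H_def by measurable
  have H_step: "H (Suc t) (step s) \<omega> \<longleftrightarrow> X (Suc t) \<omega> = s \<and> H t x \<omega>" for s \<omega>
    by (auto simp: H_def step_def le_Suc_eq)
  have S_Suc: "S t (Suc n) \<omega> = of_bool (X (Suc t) \<omega> = 0) + S (Suc t) n \<omega>" for \<omega>
    unfolding S_def by (subst sum.atLeast_Suc_atMost) simp_all
  have prob_step: "\<P>(\<omega> in M. H (Suc t) (step s) \<omega>) = \<P>(\<omega> in M. H t x \<omega>) * P (x t) s"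
    if "s \<in> {0, 1}" for s
  proof (cases "\<P>(\<omega> in M. H t x \<omega>) > 0")
    case True
    have markov: "\<P>(\<omega> in M. H t y \<omega>) > 0 \<Longrightarrow>
        \<P>(\<omega> in M. X (Suc t) \<omega> = y (Suc t) \<bar> H t y \<omega>) = P (y t) (y (Suc t))"
      if "\<forall>m\<le>Suc t. y m \<in> {0, 1}" for y
      using X that unfolding markov_chain_def H_def by blast
    have same: "H t (step s) = H t x" by (auto simp: H_def step_def)
    have "\<forall>m\<le>Suc t. step s m \<in> {0, 1}"
      using Suc.prems that by (auto simp: step_def)
    from markov[OF this] have "\<P>(\<omega> in M. X (Suc t) \<omega> = s \<bar> H t x \<omega>) = P (x t) s"
      using True unfolding same by (simp add: step_def)
    then show ?thesis
      using True by (simp add: cond_prob_def H_step field_simps)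
  next
    \<comment> \<open>A null history stays null when extended, so both sides are 0.\<close>
    case False
    then have "\<P>(\<omega> in M. H t x \<omega>) = 0" by (simp add: zero_less_measure_iff)
    moreover have "\<P>(\<omega> in M. H (Suc t) (step s) \<omega>) \<le> \<P>(\<omega> in M. H t x \<omega>)"
      by (rule finite_measure_mono) (auto simp: H_step)
    ultimately show ?thesis by (simp add: measure_le_0_iff)
  qed
  have IH: "\<P>(\<omega> in M. H (Suc t) (step s) \<omega> \<and> S (Suc t) n \<omega> = l) =
      \<P>(\<omega> in M. H t x \<omega>) * P (x t) s * visit_law P s n l" if "s \<in> {0, 1}" for s l
  proof -
    have "\<forall>m\<le>Suc t. step s m \<in> {0, 1}"
      using Suc.prems that by (auto simp: step_def)
    from Suc.IH[OF this, of l] show ?thesis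
      using prob_step[OF that] by (simp add: H_def S_def step_def)
  qed
  \<comment> \<open>The state at time \<open>Suc t\<close> splits the event into two disjoint ones:
    entering 1 leaves \<open>k\<close> visits to come, entering 0 already counts as one.\<close>
  have "\<P>(\<omega> in M. H t x \<omega> \<and> S t (Suc n) \<omega> = k) =
      \<P>(\<omega> in M. H (Suc t) (step 1) \<omega> \<and> S (Suc t) n \<omega> = k) +
      \<P>(\<omega> in M. H (Suc t) (step 0) \<omega> \<and> Suc (S (Suc t) n \<omega>) = k)"
  proof (subst finite_measure_Union[symmetric])
    show "\<P>(\<omega> in M. H t x \<omega> \<and> S t (Suc n) \<omega> = k) =
      prob ({\<omega> \<in> space M. H (Suc t) (step 1) \<omega> \<and> S (Suc t) n \<omega> = k} \<union>
        {\<omega> \<in> space M. H (Suc t) (step 0) \<omega> \<and> Suc (S (Suc t) n \<omega>) = k})"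
      using X01[of _ "Suc t"]
      by (intro arg_cong[where f = prob]) (fastforce simp: H_step S_Suc split: if_splits)
  qed (measurable, auto simp: H_step)
  also have "\<dots> = \<P>(\<omega> in M. H t x \<omega>) * visit_law P (x t) (Suc n) k"
    by (cases k) (simp_all add: IH algebra_simps)
  finally show ?case by (simp add: S_def H_def)
qed

text \<open>The case \<open>t = 0\<close>: dividing by the positive probability of
  \<open>X 0 = i\<close> turns the joint probability into the conditional one.\<close>

lemma visit_prob_eq_visit_law:
  assumes X: "markov_chain M {0, 1} P X" and i: "i \<in> {0, 1}" and pos: "\<P>(\<omega> in M. X 0 \<omega> = i) > 0"
  shows "visit_prob M X i n k = visit_law P i n k"
  using prob_history_visits[OF X, of 0 "\<lambda>_. i" n k] i pos
  by (simp add: visit_prob_def visits_def cond_prob_def conj_commute)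

section \<open>Closed forms for both starting states\<close>

theorem theorem1:
  fixes p q :: real and M :: "'a measure" and X :: "nat \<Rightarrow> 'a \<Rightarrow> nat"
  assumes p: "0 < p" "p < 1" and q: "0 < q" "q < 1"
    and X: "markov_chain M {0, 1} (two_state_matrix p q) X"
  defines "r \<equiv> 1 - p - q"
  shows
    "(p + q = 1 \<longrightarrow>
        (\<forall>i\<in>{0, 1}. \<P>(\<omega> in M. X 0 \<omega> = i) > 0 \<longrightarrow>
          (\<forall>n\<ge>1. \<forall>k\<le>n. visit_prob M X i n k = real (n choose k) * q ^ k * p ^ (n - k)))) \<and>
     (p + q \<noteq> 1 \<longrightarrow>
        (\<P>(\<omega> in M. X 0 \<omega> = 0) > 0 \<longrightarrow>
          (\<forall>n\<ge>1. visit_prob M X 0 n n = (1 - p) ^ n) \<and>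
          (\<forall>n\<ge>1. \<forall>k<n. visit_prob M X 0 n k =
             p * (1 - q) powi (int n - (2 * int k + 1)) *
             (\<Sum>j=0..min k (n - k).
                real ((n - k) choose j) * real ((n - j) choose (k - j)) *
                (1 - real j / real (n - k) * q) *
                (1 - q) ^ (k - j) * (1 - p) ^ (k - j) * (- r) ^ j))) \<and>
        (\<P>(\<omega> in M. X 0 \<omega> = 1) > 0 \<longrightarrow>
          (\<forall>n\<ge>1. visit_prob M X 1 n 0 = (1 - q) ^ n) \<and>
          (\<forall>n\<ge>1. \<forall>k\<in>{1..n}. visit_prob M X 1 n k =
             q * (1 - p) powi (2 * int k - 1 - int n) *
             (\<Sum>j=0..min k (n - k).
                real (k choose j) * real ((n - j) choose (n - k - j)) *
                (1 - real j / real k * p) *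
                (1 - p) ^ (n - k - j) * (1 - q) ^ (n - k - j) * (- r) ^ j))))"
proof -
  \<comment> \<open>Part (b) is part (a) for the chain with \<open>p\<close> and \<open>q\<close>
    exchanged, taken at \<open>n - k\<close>; \<open>1 \<le> k\<close> supplies
    \<open>n - k < n\<close>, and \<open>r\<close> is symmetric in \<open>p\<close> and
    \<open>q\<close>.\<close>
  have from_1: "visit_law (two_state_matrix p q) 1 n k =
      q * (1 - p) powi (2 * int k - 1 - int n) *
      (\<Sum>j=0..min k (n - k).
         real (k choose j) * real ((n - j) choose (n - k - j)) *
         (1 - real j / real k * p) *
         (1 - p) ^ (n - k - j) * (1 - q) ^ (n - k - j) * (- r) ^ j)"
    if "k \<in> {1..n}" for n k
  proof -
    have k: "n - (n - k) = k" "n - k < n" "int n - (2 * int (n - k) + 1) = 2 * int k - 1 - int n"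
      "1 - q - p = 1 - p - q"
      using that by (auto simp: of_nat_diff)
    have "visit_law (two_state_matrix p q) 1 n k = visit_law (two_state_matrix q p) 0 n (n - k)"
      using that by (subst visit_law_swap_states) simp_all
    also note visit_law_formula[OF k(2) p(2), of q]
    finally show ?thesis
      unfolding k(1,3,4) r_def by (simp only: min.commute)
  qed
  show ?thesis
    using visit_law_iid visit_law_formula[OF _ q(2)] from_1
      visit_law_diagonal[of "two_state_matrix p q"] visit_law_0_right[of "two_state_matrix p q"]
      visit_prob_eq_visit_law[OF X]
    by (auto simp: r_def two_state_matrix_def)
qed

end
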